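(* The generating function $T_3(x)=\sum_{n\ge 0} t_n^{\#3}x^n$ of the sequence $\{t_n^{\#3}\}_{n\geq0}$ is $$T_3(x)= \frac{2+2\sqrt{1-8x}-\sqrt{2+2\sqrt{1-8x}+8x}-\sqrt{1-8x}\,\sqrt{2+2\sqrt{1-8x}+8x}}{8}.$$
   Context: A bracketed implication with $n$ distinct variables is a formula obtained from $p_1\to p_2\to\cdots\to p_n$ (variables in this fixed order) by fully inserting brackets; for $n\ge2$ it has the form $\psi\to\phi$ with $\psi$ a bracketing of $p_1\to\cdots\to p_i$ and $\phi$ a bracketing of $p_{i+1}\to\cdots\to p_n$ for some $1\le i\le n-1$. A row is a pair consisting of a bracketed formula and a valuation of $p_1,\dots,p_n$ in $\{0,1\}$ (0 = false, 1 = true). For $n\ge 2$, $t_n^{\#3}$ is the number of rows (over all bracketed implications in $n$ variables) for which $\psi$ and $\phi$ both have value 0 (so that $\psi\to\phi$ is true); $t_0^{\#3}=t_1^{\#3}=0$. Square roots denote formal power series with positive constant term. *)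

theory Defs
  imports
    Complex_Main
    "HOL-Library.FuncSet"
    "HOL-Computational_Algebra.Formal_Power_Series"
begin

datatype formula = Var nat | Imp formula formula

primrec value_of :: "(nat \<Rightarrow> bool) \<Rightarrow> formula \<Rightarrow> bool" where
  "value_of v (Var i) = v i"
| "value_of v (Imp \<psi> \<phi>) = (value_of v \<psi> \<longrightarrow> value_of v \<phi>)"

primrec variables :: "formula \<Rightarrow> nat list" where
  "variables (Var i) = [i]"
| "variables (Imp \<psi> \<phi>) = variables \<psi> @ variables \<phi>"

text \<open>Erasing the brackets of a formula leaves its list of variables, so the full bracketings of
  \<open>p\<^sub>1 \<rightarrow> \<dots> \<rightarrow> p\<^sub>n\<close> are the formulas whose variables, read from left to right, are
  \<open>1, \<dots>, n\<close>.\<close>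

definition bracketed_implications :: "nat \<Rightarrow> formula set" where
  "bracketed_implications n = {f. variables f = [1..<Suc n]}"

text \<open>A valuation is defined on \<open>p\<^sub>1, \<dots>, p\<^sub>n\<close> only; taking extensional functions makes
  it determined by its values there, so that valuations can be counted.\<close>

definition valuations :: "nat \<Rightarrow> (nat \<Rightarrow> bool) set" where
  "valuations n = {1..n} \<rightarrow>\<^sub>E UNIV"

definition rows :: "nat \<Rightarrow> (formula \<times> (nat \<Rightarrow> bool)) set" where
  "rows n = bracketed_implications n \<times> valuations n"

definition t3 :: "nat \<Rightarrow> nat" where
  "t3 n = (if n < 2 then 0 else
     card {(f, v) \<in> rows n. \<exists>\<psi> \<phi>. f = Imp \<psi> \<phi> \<and> \<not> value_of v \<psi> \<and> \<not> value_of v \<phi>})"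

text \<open>The cardinality above is a genuine count: there are finitely many rows.\<close>

lemma variables_neq_Nil: "variables f \<noteq> []"
  by (induction f) auto

lemma finite_formulas_with_variables: "finite {f. variables f = xs}"
proof (induction xs rule: length_induct)
  case (1 xs)
  let ?V = "\<lambda>ys. {f. variables f = ys}"
  let ?C = "\<Union>k\<in>{1..<length xs}. (\<lambda>(\<psi>, \<phi>). Imp \<psi> \<phi>) ` (?V (take k xs) \<times> ?V (drop k xs))"
  have "f \<in> Var ` set xs \<union> ?C" if f: "variables f = xs" for f
  proof (cases f)
    case (Var i)
    with f show ?thesis by auto
  next
    case (Imp \<psi> \<phi>)
    have "length (variables \<psi>) \<in> {1..<length xs}"
      using f Imp variables_neq_Nil[of \<psi>] variables_neq_Nil[of \<phi>] by (auto simp: Suc_le_eq)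
    moreover have "variables \<psi> = take (length (variables \<psi>)) xs"
      and "variables \<phi> = drop (length (variables \<psi>)) xs"
      using f Imp by auto
    ultimately show ?thesis using Imp by blast
  qed
  then have "?V xs \<subseteq> Var ` set xs \<union> ?C" by blast
  moreover have "finite (Var ` set xs \<union> ?C)"
    using 1 by (auto intro!: finite_imageI finite_cartesian_product)
  ultimately show ?case by (rule finite_subset)
qed

lemma finite_rows: "finite (rows n)"
  unfolding rows_def bracketed_implications_def valuations_def
  by (rule finite_cartesian_product[OF finite_formulas_with_variables finite_PiE]) auto

definition fps_sqrt :: "real fps \<Rightarrow> real fps" where
  "fps_sqrt a = fps_radical root 2 a"

text \<open>On series with positive constant term this is the unique square root with positive
  constant term.\<close>

lemma fps_sqrt_iff:
  assumes "fps_nth a 0 > 0"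
  shows "b = fps_sqrt a \<longleftrightarrow> b ^ 2 = a \<and> fps_nth b 0 > 0"
proof -
  have r: "root (Suc 1) (fps_nth a 0) ^ Suc 1 = fps_nth a 0"
    using assms by (intro real_root_pow_pos2) auto
  have pos: "root (Suc 1) (fps_nth a 0) > 0"
    using assms by (intro real_root_gt_zero) auto
  have sqrt: "fps_sqrt a = fps_radical root (Suc 1) a"
    by (simp add: fps_sqrt_def numeral_2_eq_2)
  have a0: "fps_nth a 0 \<noteq> 0" using assms by simp
  show ?thesis
  proof
    assume b: "b = fps_sqrt a"
    have "fps_nth b 0 > 0" using pos unfolding b sqrt by simp
    moreover have "b ^ Suc 1 = a"
      unfolding b sqrt by (rule iffD1[OF power_radical[of a root 1, OF a0] r])
    ultimately show "b ^ 2 = a \<and> fps_nth b 0 > 0"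
      by (metis Suc_1)
  next
    assume b: "b ^ 2 = a \<and> fps_nth b 0 > 0"
    then have ba: "b ^ Suc 1 = a" by (metis Suc_1)
    have "fps_nth a 0 = fps_nth b 0 ^ Suc 1"
      unfolding ba[symmetric] by (rule fps_nth_power_0)
    then have "root (Suc 1) (fps_nth a 0) = fps_nth b 0"
      using real_root_power_cancel[of "Suc 1" "fps_nth b 0"] b by simp
    then show "b = fps_sqrt a"
      unfolding sqrt using radical_unique[of root 1 a b, OF r _ a0] ba by blast
  qed
qed

end

(*
  Writing the value of each variable at its leaf turns a row into a full binary tree with leaves
  in {0,1}, and this is a bijection.  For trees the symbolic method applies: with G and F the
  generating functions of all trees and of the trees with value 0,
    G = 2x + G^2,   F = x + (G - F) F,   T_3 = F^2.
  Hence S = 1 - 2G and R = 2 - 2G + 4F.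
*)
theory Submission
  imports Defs
begin

datatype btree = Leaf bool | Node btree btree

primrec leaves :: "btree \<Rightarrow> bool list" where
  "leaves (Leaf b) = [b]"
| "leaves (Node s t) = leaves s @ leaves t"

primrec value_tree :: "btree \<Rightarrow> bool" where
  "value_tree (Leaf b) = b"
| "value_tree (Node s t) = (value_tree s \<longrightarrow> value_tree t)"

primrec row_tree :: "(nat \<Rightarrow> bool) \<Rightarrow> formula \<Rightarrow> btree" where
  "row_tree v (Var i) = Leaf (v i)"
| "row_tree v (Imp \<psi> \<phi>) = Node (row_tree v \<psi>) (row_tree v \<phi>)"

lemma leaves_neq_Nil [simp]: "leaves t \<noteq> []"
  by (induction t) auto

lemma leaves_row_tree: "leaves (row_tree v f) = map v (variables f)"
  by (induction f) auto

lemma value_row_tree: "value_tree (row_tree v f) = value_of v f"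
  by (induction f) auto

text \<open>Leaves keep only values and forget variable indices, so the variable lists must be
  compared separately.\<close>

lemma row_tree_inject:
  assumes "row_tree v f = row_tree w g" "variables f = variables g"
  shows "f = g"
  using assms
proof (induction f arbitrary: g)
  case (Var i)
  then show ?case by (cases g) auto
next
  case (Imp \<psi> \<phi>)
  then obtain \<psi>' \<phi>' where g: "g = Imp \<psi>' \<phi>'"
    by (cases g) auto
  with Imp.prems have eq: "row_tree v \<psi> = row_tree w \<psi>'" "row_tree v \<phi> = row_tree w \<phi>'"
    by auto
  \<comment> \<open>Equal left subtrees have equally many leaves, so both variable lists split at
    the same position.\<close>
  from eq(1) have "length (variables \<psi>) = length (variables \<psi>')"
    by (metis leaves_row_tree length_map)
  with Imp.prems g have "variables \<psi> = variables \<psi>'" "variables \<phi> = variables \<phi>'"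
    by auto
  with Imp.IH eq g show ?case by blast
qed

text \<open>The split of the leaf list at the root pulls back along \<open>map v\<close> to a split
  of \<open>xs\<close>. The list stays arbitrary because subformulas carry only segments of
  it.\<close>

lemma row_tree_surject:
  assumes "leaves t = map v xs"
  shows "\<exists>f. variables f = xs \<and> row_tree v f = t"
  using assms
proof (induction t arbitrary: xs)
  case (Leaf b)
  then obtain i where "xs = [i]" "v i = b" by auto
  then have "variables (Var i) = xs \<and> row_tree v (Var i) = Leaf b" by simp
  then show ?case by blast
next
  case (Node s t)
  then obtain ys zs where xs: "xs = ys @ zs" and "leaves s = map v ys" "leaves t = map v zs"
    by (auto simp: append_eq_map_conv)
  with Node.IH obtain \<psi> \<phi> where "variables \<psi> = ys" "row_tree v \<psi> = s"
    "variables \<phi> = zs" "row_tree v \<phi> = t" by metis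
  with xs have "variables (Imp \<psi> \<phi>) = xs \<and> row_tree v (Imp \<psi> \<phi>) = Node s t" by simp
  then show ?case by blast
qed

lemma bij_betw_row_tree:
  "bij_betw (\<lambda>(f, v). row_tree v f) (rows n) {t. length (leaves t) = n}"
  unfolding bij_betw_def
proof (intro conjI inj_onI equalityI subsetI)
  fix p q assume p: "p \<in> rows n" and q: "q \<in> rows n"
    and eq: "(case p of (f, v) \<Rightarrow> row_tree v f) = (case q of (f, v) \<Rightarrow> row_tree v f)"
  obtain f v g w where pq: "p = (f, v)" "q = (g, w)" by (cases p, cases q) auto
  from p q pq have vars: "variables f = [1..<Suc n]" "variables g = [1..<Suc n]"
    and ext: "v \<in> {1..n} \<rightarrow>\<^sub>E UNIV" "w \<in> {1..n} \<rightarrow>\<^sub>E UNIV"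
    by (auto simp: rows_def bracketed_implications_def valuations_def)
  from eq pq have tree: "row_tree v f = row_tree w g" by simp
  with vars have "map v [1..<Suc n] = map w [1..<Suc n]"
    by (metis leaves_row_tree)
  \<comment> \<open>Agreement on \<open>{1..n}\<close> suffices for \<open>v = w\<close>, as both
    valuations are extensional.\<close>
  then have "v i = w i" if "i \<in> {1..n}" for i
    using that by (auto simp del: upt_Suc)
  with ext have "v = w" by (blast intro: PiE_ext)
  with pq row_tree_inject[OF tree] vars show "p = q" by simp
next
  fix t assume "t \<in> (\<lambda>(f, v). row_tree v f) ` rows n"
  then show "t \<in> {t. length (leaves t) = n}"
    by (auto simp: rows_def bracketed_implications_def leaves_row_tree)
next
  fix t assume "t \<in> {t. length (leaves t) = n}"
  then have len: "length (leaves t) = n" by simp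
  \<comment> \<open>Variables are numbered from 1 and list positions from 0, hence the shift. The
    restriction makes \<open>v\<close> extensional.\<close>
  define v where "v = restrict (\<lambda>i. leaves t ! (i - 1)) {1..n}"
  have "leaves t = map v [1..<Suc n]"
    by (rule nth_equalityI) (auto simp: len v_def simp del: upt_Suc)
  then obtain f where "variables f = [1..<Suc n]" "row_tree v f = t"
    using row_tree_surject by blast
  moreover have "v \<in> valuations n" by (simp add: v_def valuations_def)
  ultimately show "t \<in> (\<lambda>(f, v). row_tree v f) ` rows n"
    by (force simp: rows_def bracketed_implications_def)
qed

text \<open>Finiteness of the rows carries over along the bijection. The set has the form counted by
  the generating functions below, so that \<open>auto\<close> settles the side conditions of the
  cardinality rules.\<close>

lemma finite_trees [simp]: "finite {t. t \<in> A \<and> length (leaves t) = n}"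
proof (rule finite_subset)
  show "finite {t. length (leaves t) = n}"
    using bij_betw_finite[OF bij_betw_row_tree] finite_rows by blast
qed auto

definition tree_gf :: "btree set \<Rightarrow> real fps" where
  "tree_gf A = Abs_fps (\<lambda>n. real (card {t \<in> A. length (leaves t) = n}))"

lemma tree_gf_nth_0 [simp]: "fps_nth (tree_gf A) 0 = 0"
  by (simp add: tree_gf_def)

lemma tree_gf_Un:
  assumes "A \<inter> B = {}"
  shows "tree_gf (A \<union> B) = tree_gf A + tree_gf B"
proof (rule fps_ext)
  fix n
  have "{t \<in> A \<union> B. length (leaves t) = n} =
      {t \<in> A. length (leaves t) = n} \<union> {t \<in> B. length (leaves t) = n}"
    by blast
  moreover have "card \<dots> = card {t \<in> A. length (leaves t) = n} + card {t \<in> B. length (leaves t) = n}"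
    using assms by (intro card_Un_disjoint) auto
  ultimately show "fps_nth (tree_gf (A \<union> B)) n = fps_nth (tree_gf A + tree_gf B) n"
    by (simp add: tree_gf_def)
qed

lemma tree_gf_Leaf: "tree_gf {Leaf b} = fps_X"
proof (rule fps_ext)
  fix n
  have "{t \<in> {Leaf b}. length (leaves t) = n} = (if n = 1 then {Leaf b} else {})"
    by auto
  then show "fps_nth (tree_gf {Leaf b}) n = fps_nth fps_X n"
    by (simp add: tree_gf_def)
qed

text \<open>\<open>Node\<close> is injective and adds leaf counts. Sorting pairs by the leaf count
  \<open>i\<close> of the left subtree gives disjoint products, whose sizes sum to the Cauchy
  product.\<close>

lemma tree_gf_Node: "tree_gf (case_prod Node ` (A \<times> B)) = tree_gf A * tree_gf B"
proof (rule fps_ext)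
  fix n
  let ?a = "\<lambda>A n. {t \<in> A. length (leaves t) = n}"
  have "?a (case_prod Node ` (A \<times> B)) n = case_prod Node ` (\<Union>i\<in>{0..n}. ?a A i \<times> ?a B (n - i))"
    by force
  then have "card (?a (case_prod Node ` (A \<times> B)) n) =
      card (case_prod Node ` (\<Union>i\<in>{0..n}. ?a A i \<times> ?a B (n - i)))"
    by (rule arg_cong)
  also have "\<dots> = card (\<Union>i\<in>{0..n}. ?a A i \<times> ?a B (n - i))"
    by (rule card_image) (auto simp: inj_on_def)
  also have "\<dots> = (\<Sum>i=0..n. card (?a A i \<times> ?a B (n - i)))"
    by (rule card_UN_disjoint) auto
  finally show "fps_nth (tree_gf (case_prod Node ` (A \<times> B))) n = fps_nth (tree_gf A * tree_gf B) n"
    by (simp add: tree_gf_def fps_mult_nth card_cartesian_product)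
qed

definition false_trees :: "btree set" where
  "false_trees = {t. \<not> value_tree t}"

lemma tree_gf_UNIV: "tree_gf UNIV = 2 * fps_X + tree_gf UNIV ^ 2"
proof -
  let ?U = "{Leaf True} \<union> ({Leaf False} \<union> case_prod Node ` (UNIV \<times> UNIV))"
  have "t \<in> ?U" for t
    by (cases t) (auto simp: image_iff)
  then have "tree_gf UNIV = tree_gf ?U"
    by (intro arg_cong[where f = tree_gf]) blast
  also have "\<dots> = fps_X + tree_gf ({Leaf False} \<union> case_prod Node ` (UNIV \<times> UNIV))"
    by (subst tree_gf_Un) (auto simp: tree_gf_Leaf)
  also have "tree_gf ({Leaf False} \<union> case_prod Node ` (UNIV \<times> UNIV)) =
      fps_X + tree_gf UNIV * tree_gf UNIV"
    \<comment> \<open>The product \<open>UNIV \<times> UNIV\<close> must not collapse to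
      \<open>UNIV\<close>, or \<open>tree_gf_Node\<close> would no longer match.\<close>
    by (subst tree_gf_Un) (auto simp: tree_gf_Leaf tree_gf_Node simp del: UNIV_Times_UNIV)
  finally show ?thesis by (simp add: power2_eq_square)
qed

text \<open>An implication is false exactly when its left side is true and its right side false;
  true trees are counted by complement.\<close>

lemma tree_gf_false_trees:
  "tree_gf false_trees = fps_X + (tree_gf UNIV - tree_gf false_trees) * tree_gf false_trees"
proof -
  have "t \<in> false_trees \<longleftrightarrow>
      t \<in> {Leaf False} \<union> case_prod Node ` ((- false_trees) \<times> false_trees)" for t
    by (cases t) (auto simp: false_trees_def image_iff)
  then have "tree_gf false_trees =
      tree_gf ({Leaf False} \<union> case_prod Node ` ((- false_trees) \<times> false_trees))"
    by (intro arg_cong[where f = tree_gf]) blast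
  also have "\<dots> = fps_X + tree_gf (- false_trees) * tree_gf false_trees"
    by (subst tree_gf_Un) (auto simp: tree_gf_Leaf tree_gf_Node)
  also have "tree_gf (- false_trees) = tree_gf UNIV - tree_gf false_trees"
    using tree_gf_Un[of "- false_trees" false_trees] by simp
  finally show ?thesis .
qed

text \<open>The bijection sends the counted rows to the nodes with two false subtrees. For
  \<open>n < 2\<close> the default value 0 is right as well, since a node has at least two
  leaves.\<close>

lemma t3_eq_card:
  "t3 n = card {t \<in> case_prod Node ` (false_trees \<times> false_trees). length (leaves t) = n}"
proof (cases "n < 2")
  case True
  have two: "length (leaves s @ leaves t) \<ge> 2" for s t
    using leaves_neq_Nil[of s] leaves_neq_Nil[of t]
    by (cases "leaves s"; cases "leaves t") auto
  have "length (leaves u) \<noteq> n" if "u \<in> case_prod Node ` (false_trees \<times> false_trees)" for u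
  proof -
    from \<open>u \<in> _\<close> obtain s t where "u = Node s t" by auto
    with two[of s t] True show ?thesis by simp
  qed
  then have "{t \<in> case_prod Node ` (false_trees \<times> false_trees). length (leaves t) = n} = {}"
    by blast
  with True show ?thesis by (simp only: t3_def if_True card.empty)
next
  case False
  let ?h = "\<lambda>(f, v). row_tree v f"
  let ?R = "{(f, v) \<in> rows n. \<exists>\<psi> \<phi>. f = Imp \<psi> \<phi> \<and> \<not> value_of v \<psi> \<and> \<not> value_of v \<phi>}"
  let ?N = "case_prod Node ` (false_trees \<times> false_trees)"
  have iff: "row_tree v f \<in> ?N \<longleftrightarrow>
      (\<exists>\<psi> \<phi>. f = Imp \<psi> \<phi> \<and> \<not> value_of v \<psi> \<and> \<not> value_of v \<phi>)" for f v
    by (cases f) (auto simp: false_trees_def value_row_tree image_iff)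
  have "?R = {p \<in> rows n. ?h p \<in> ?N}"
  proof (rule set_eqI)
    fix p show "p \<in> ?R \<longleftrightarrow> p \<in> {p \<in> rows n. ?h p \<in> ?N}"
      by (cases p) (simp only: mem_Collect_eq prod.case iff)
  qed
  then have "?h ` ?R = {t \<in> ?h ` rows n. t \<in> ?N}"
    by (simp only:) blast
  also have "\<dots> = {t \<in> ?N. length (leaves t) = n}"
    unfolding bij_betw_imp_surj_on[OF bij_betw_row_tree[of n]] by blast
  finally have img: "?h ` ?R = {t \<in> ?N. length (leaves t) = n}" .
  have "inj_on ?h ?R"
    using bij_betw_imp_inj_on[OF bij_betw_row_tree[of n]] by (rule inj_on_subset) auto
  from card_image[OF this] False show ?thesis
    by (simp only: img t3_def if_False)
qed

theorem proposition4p3: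
  fixes T\<^sub>3 S R :: "real fps"
  defines "T\<^sub>3 \<equiv> Abs_fps (\<lambda>n. real (t3 n))"
    and "S \<equiv> fps_sqrt (1 - 8 * fps_X)"
    and "R \<equiv> fps_sqrt (2 + 2 * S + 8 * fps_X)"
  shows "T\<^sub>3 = (2 + 2 * S - R - S * R) / 8"
proof -
  define G where "G = tree_gf UNIV"
  define F where "F = tree_gf false_trees"
  have G: "G = 2 * fps_X + G ^ 2" and F: "F = fps_X + (G - F) * F"
    unfolding G_def F_def by (rule tree_gf_UNIV, rule tree_gf_false_trees)
  have nth_0: "fps_nth G 0 = 0" "fps_nth F 0 = 0"
    by (simp_all add: G_def F_def)
  have T: "T\<^sub>3 = F * F"
    by (simp add: T\<^sub>3_def F_def t3_eq_card flip: tree_gf_Node tree_gf_def)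
  \<comment> \<open>Completing the square in the quadratic equation for \<open>G\<close>.\<close>
  have "(1 - 2 * G) ^ 2 = 1 - 8 * fps_X"
    using G by algebra
  \<comment> \<open>The constant term 1 selects the positive root.\<close>
  then have S: "S = 1 - 2 * G"
    unfolding S_def by (subst eq_commute, subst fps_sqrt_iff) (auto simp: nth_0)
  \<comment> \<open>Completing the square in \<open>F^2 + (1 - G) * F = fps_X\<close> gives
    \<open>(1 - G + 2 * F)^2 = (1 - G)^2 + 4 * fps_X\<close>. Multiply by 4 and eliminate
    \<open>G^2\<close>; the root has constant term 2.\<close>
  have "(2 - 2 * G + 4 * F) ^ 2 = 2 + 2 * S + 8 * fps_X"
    using G F S by algebra
  then have R: "R = 2 - 2 * G + 4 * F"
    unfolding R_def by (subst eq_commute, subst fps_sqrt_iff) (auto simp: nth_0 S)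
  \<comment> \<open>The left side factors as
    \<open>(1 + S) * (2 - R) = 4 * (1 - G) * (G - 2 * F)\<close>. Now insert
    \<open>(1 - G) * G = 2 * fps_X\<close> and \<open>(1 - G) * F = fps_X - F^2\<close>; the terms
    in \<open>fps_X\<close> cancel and \<open>8 * F^2\<close> remains.\<close>
  have "2 + 2 * S - R - S * R = 8 * T\<^sub>3"
    using G F S R T by algebra
  then show ?thesis by simp
qed

end
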